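(* Let $\mathcal{X}$ be compact, $f\in C(\mathcal{X})^d$, and let $V\subset C(\mathcal{X})^d$ be a linear subspace of dimension $n$. Let $u\in V$ and let $\mathcal{A}:=\{x\in\mathcal{X}\mid |\varepsilon(x)|=\|\varepsilon\|\}$ be the set of extreme points of $\varepsilon:=f-u$. The following statements are equivalent: (i) $u$ is a best approximation to $f$ in $V$, i.e. $\|f-u\|=\min_{v\in V}\|f-v\|$. (ii) There exist $\nu\le n+1$ points $x_1,x_2,\dots,x_\nu\in\mathcal{A}$ such that for all $v\in V$ $$\min_{1\le i\le\nu}\langle\varepsilon(x_i),v(x_i)\rangle\le 0.$$ (iii) There exist $\nu\le n+1$ points $x_1,x_2,\dots,x_\nu\in\mathcal{A}$ and $\nu$ weights $w_1,w_2,\dots,w_\nu\ge 0$, $\sum_{i=1}^\nu w_i=1$, such that the functional $$\ell(g):=\frac{1}{\|\varepsilon\|}\sum_{i=1}^\nu w_i\,\langle\varepsilon(x_i),g(x_i)\rangle$$ satisfies $$\ell(\varepsilon)=\|\varepsilon\|,\qquad \|\ell\|=1\quad\text{and}\quad V\subset\ker(\ell),$$ where $\ker(\ell)=\{v\in V\mid \ell(v)=0\}$ (so the last condition says that $\ell(v)=0$ for all $v\in V$).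
   Context: $C(\mathcal{X})^d$ is the space of continuous $\mathbb{R}^d$-valued functions on the compact set $\mathcal{X}$. Fixed positive weights $p_1,\dots,p_d$ with sum $1$ define the inner product $\langle\tilde r,r\rangle=\sum_{l=1}^d p_l\tilde r_l r_l$ and the norm $|r|$, $|r|^2=\sum_{l=1}^d p_l|r_l|^2$, on $\mathbb{R}^d$. For $g\in C(\mathcal{X})^d$, $\|g\|=\sup_{x\in\mathcal{X}}|g(x)|$; $\|\ell\|$ denotes the operator norm of the linear functional $\ell$ on $(C(\mathcal{X})^d,\|\cdot\|)$. *)

theory Defs
  imports "HOL-Analysis.Analysis"
begin

text \<open>
  The compact set is a type \<open>'x\<close> whose topology is compact, so that \<open>'x \<Rightarrow>\<^sub>C (real ^ 'd)\<close>
  (bounded continuous functions) is the full space of continuous \<open>real ^ 'd\<close>-valued functions.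
  The library norms on \<open>real ^ 'd\<close> and on \<open>'x \<Rightarrow>\<^sub>C (real ^ 'd)\<close> are the unweighted ones and are
  not used; the norms below all refer to the weights \<open>p\<close>.
\<close>

definition winner :: "('d::finite \<Rightarrow> real) \<Rightarrow> real ^ 'd \<Rightarrow> real ^ 'd \<Rightarrow> real" where
  "winner p a b = (\<Sum>l\<in>UNIV. p l * (a $ l) * (b $ l))"

definition wnorm :: "('d::finite \<Rightarrow> real) \<Rightarrow> real ^ 'd \<Rightarrow> real" where
  "wnorm p r = sqrt (\<Sum>l\<in>UNIV. p l * \<bar>r $ l\<bar>\<^sup>2)"

definition wsupnorm ::
    "('d::finite \<Rightarrow> real) \<Rightarrow> ('x::topological_space \<Rightarrow>\<^sub>C (real ^ 'd)) \<Rightarrow> real" where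
  "wsupnorm p g = (SUP x. wnorm p (g x))"

text \<open>
  The operator norm with respect to \<open>wsupnorm\<close>, in the style of \<open>onorm\<close>: the zero function
  contributes \<open>0 / 0 = 0\<close>. As for \<open>onorm\<close>, the value is meaningful for bounded functionals only.
\<close>

definition wopnorm ::
    "('d::finite \<Rightarrow> real) \<Rightarrow> (('x::topological_space \<Rightarrow>\<^sub>C (real ^ 'd)) \<Rightarrow> real) \<Rightarrow> real" where
  "wopnorm p L = (SUP g. \<bar>L g\<bar> / wsupnorm p g)"

definition extreme_points ::
    "('d::finite \<Rightarrow> real) \<Rightarrow> ('x::topological_space \<Rightarrow>\<^sub>C (real ^ 'd)) \<Rightarrow> 'x set" where
  "extreme_points p e = {x. wnorm p (e x) = wsupnorm p e}"

definition best_approximation ::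
    "('d::finite \<Rightarrow> real) \<Rightarrow> ('x::topological_space \<Rightarrow>\<^sub>C (real ^ 'd)) \<Rightarrow>
     ('x \<Rightarrow>\<^sub>C (real ^ 'd)) set \<Rightarrow> ('x \<Rightarrow>\<^sub>C (real ^ 'd)) \<Rightarrow> bool" where
  "best_approximation p f V u \<longleftrightarrow>
     u \<in> V \<and> (\<forall>v\<in>V. wsupnorm p (f - u) \<le> wsupnorm p (f - v))"

definition point_functional ::
    "('d::finite \<Rightarrow> real) \<Rightarrow> ('x::topological_space \<Rightarrow>\<^sub>C (real ^ 'd)) \<Rightarrow>
     nat \<Rightarrow> (nat \<Rightarrow> 'x) \<Rightarrow> (nat \<Rightarrow> real) \<Rightarrow> ('x \<Rightarrow>\<^sub>C (real ^ 'd)) \<Rightarrow> real" where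
  "point_functional p e \<nu> x w g =
     1 / wsupnorm p e * (\<Sum>i=1..\<nu>. w i * winner p (e (x i)) (g (x i)))"

end

theory Submission
  imports Defs
begin

text \<open>
  If \<open>u\<close> is a best approximation, consider the moment map \<open>x \<mapsto> (\<langle>\<epsilon>(x), b(x)\<rangle>)\<close>, indexed by the
  basis functions \<open>b\<close>, on the compact set of extreme points. Among all convex combinations of \<open>n + 1\<close> of its
  values choose one, \<open>y\<close>, of least Euclidean length. By the exchange argument behind
  Caratheodory's theorem \<open>y\<close> is also shortest among combinations of \<open>n + 2\<close> values, in particular
  on the segments from \<open>y\<close> to the values of the map. So if \<open>y \<noteq> 0\<close>, then \<open>v = \<Sum>\<^sub>b y\<^sub>b b\<close> satisfies
  \<open>\<langle>\<epsilon>, v\<rangle> > 0\<close> at every extreme point, and \<open>u + t v\<close> beats \<open>u\<close> for small \<open>t > 0\<close>. Hence \<open>y = 0\<close>, which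
  gives the weights in (iii).
\<close>

section \<open>Linear dependencies and the exchange of points\<close>

text \<open>Gaussian elimination: a pivot solves one equation for one unknown, which leaves one
  equation and one unknown fewer.\<close>

lemma homogeneous_system_nontrivial_solution:
  fixes a :: "'b \<Rightarrow> 's \<Rightarrow> real"
  assumes "finite J" "finite S" "card J < card S"
  shows "\<exists>c. (\<exists>s\<in>S. c s \<noteq> 0) \<and> (\<forall>j\<in>J. (\<Sum>s\<in>S. c s * a j s) = 0)"
  using assms
proof (induction J arbitrary: S a rule: finite_induct)
  case empty
  then have "S \<noteq> {}" by auto
  then show ?case by (intro exI[of _ "\<lambda>_. 1"]) auto
next
  case (insert k J)
  show ?case
  proof (cases "\<forall>s\<in>S. a k s = 0")
    case True
    obtain c where "\<exists>s\<in>S. c s \<noteq> 0" "\<forall>j\<in>J. (\<Sum>s\<in>S. c s * a j s) = 0"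
      using insert.IH[of S a] insert.prems insert.hyps by auto
    then show ?thesis using True by (intro exI[of _ c]) auto
  next
    case False
    then obtain s0 where s0: "s0 \<in> S" "a k s0 \<noteq> 0" by auto
    define S' where "S' = S - {s0}"
    have fin: "finite S'" and card: "card J < card S'"
      using insert.prems insert.hyps s0 by (auto simp: S'_def)
    \<comment> \<open>The coefficients are those of row \<open>j\<close> after subtracting the
      multiple of row \<open>k\<close> that clears the entry at \<open>s0\<close>.\<close>
    obtain c where c: "\<exists>s\<in>S'. c s \<noteq> 0"
      "\<forall>j\<in>J. (\<Sum>s\<in>S'. c s * (a j s - a j s0 * a k s / a k s0)) = 0"
      using insert.IH[OF fin card, of "\<lambda>j s. a j s - a j s0 * a k s / a k s0"] by blast
    define R where "R = (\<Sum>s\<in>S'. c s * a k s)"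
    \<comment> \<open>The value at \<open>s0\<close> is what equation \<open>k\<close> forces once
      the other unknowns are given by \<open>c\<close>.\<close>
    define d where "d = c(s0 := - R / a k s0)"
    have split: "(\<Sum>s\<in>S. d s * a j s) = - R / a k s0 * a j s0 + (\<Sum>s\<in>S'. c s * a j s)" for j
    proof -
      have "(\<Sum>s\<in>S. d s * a j s) = d s0 * a j s0 + (\<Sum>s\<in>S'. d s * a j s)"
        unfolding S'_def using insert.prems s0 by (simp add: sum.remove)
      also have "(\<Sum>s\<in>S'. d s * a j s) = (\<Sum>s\<in>S'. c s * a j s)"
        by (rule sum.cong) (auto simp: d_def S'_def)
      finally show ?thesis by (simp add: d_def)
    qed
    have "(\<Sum>s\<in>S. d s * a j s) = 0" if "j \<in> J" for j
    proof -
      have "0 = (\<Sum>s\<in>S'. c s * a j s - c s * a k s * (a j s0 / a k s0))"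
        using c(2) that by (simp add: algebra_simps)
      also have "\<dots> = (\<Sum>s\<in>S'. c s * a j s) - R * (a j s0 / a k s0)"
        by (simp only: sum_subtractf R_def sum_distrib_right)
      finally show ?thesis unfolding split by simp
    qed
    moreover have "(\<Sum>s\<in>S. d s * a k s) = 0"
      unfolding split using s0 by (simp add: R_def)
    moreover have "\<exists>s\<in>S. d s \<noteq> 0"
      using c(1) by (auto simp: d_def S'_def)
    ultimately show ?thesis by (intro exI[of _ d]) auto
  qed
qed

text \<open>Subtracting a multiple of an affine dependency \<open>c\<close> changes neither the
  total weight nor the moments. The largest multiple that keeps all weights nonnegative makes one of
  them vanish.\<close>

lemma Caratheodory_exchange:
  fixes a :: "'b \<Rightarrow> 's \<Rightarrow> real" and w :: "'s \<Rightarrow> real"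
  assumes "finite J" "finite S" "card J + 1 < card S" and w: "\<And>s. s \<in> S \<Longrightarrow> 0 \<le> w s"
  obtains r w' where "r \<in> S" "w' r = 0" "\<forall>s\<in>S. 0 \<le> w' s" "sum w' S = sum w S"
    "\<forall>j\<in>J. (\<Sum>s\<in>S. w' s * a j s) = (\<Sum>s\<in>S. w s * a j s)"
proof -
  \<comment> \<open>The extra row \<open>None\<close> of ones encodes \<open>sum c S = 0\<close>; it
    accounts for the \<open>+ 1\<close> in the cardinality assumption.\<close>
  define a' where "a' j s = (case j of None \<Rightarrow> 1 | Some j \<Rightarrow> a j s)" for j s
  have "card (insert None (Some ` J)) < card S"
    using assms by (simp add: card_image)
  then obtain c where c: "\<exists>s\<in>S. c s \<noteq> 0"
      "\<forall>j\<in>insert None (Some ` J). (\<Sum>s\<in>S. c s * a' j s) = 0"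
    using homogeneous_system_nontrivial_solution[of "insert None (Some ` J)" S a'] assms by blast
  have c0: "sum c S = 0" and cJ: "\<And>j. j \<in> J \<Longrightarrow> (\<Sum>s\<in>S. c s * a j s) = 0"
    using c(2) by (auto simp: a'_def)
  define P where "P = {s\<in>S. c s > 0}"
  \<comment> \<open>A nonzero \<open>c\<close> with sum zero must be positive somewhere.\<close>
  have "P \<noteq> {}"
  proof
    assume "P = {}"
    then have "\<And>s. s \<in> S \<Longrightarrow> 0 \<le> - c s" by (auto simp: P_def not_less)
    then have "\<forall>s\<in>S. - c s = 0"
      using sum_nonneg_eq_0_iff[of S "\<lambda>s. - c s"] c0 assms(2) by (simp add: sum_negf)
    then show False using c(1) by auto
  qed
  have finP: "finite P" using assms(2) by (simp add: P_def)
  \<comment> \<open>The ratio test of the simplex method: a minimising index \<open>r\<close> is one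
    whose weight reaches zero first.\<close>
  define t where "t = Min ((\<lambda>s. w s / c s) ` P)"
  have "t \<in> (\<lambda>s. w s / c s) ` P"
    unfolding t_def using finP \<open>P \<noteq> {}\<close> by (intro Min_in) auto
  then obtain r where r: "r \<in> P" "t = w r / c r" by auto
  have t0: "0 \<le> t" using r w by (auto simp: P_def)
  have nonneg: "0 \<le> w s - t * c s" if "s \<in> S" for s
  proof (cases "c s > 0")
    case True
    then have "t \<le> w s / c s"
      unfolding t_def using that finP by (intro Min_le) (auto simp: P_def)
    then show ?thesis using True by (simp add: pos_le_divide_eq)
  next
    case False
    then have "t * c s \<le> 0" using t0 by (simp add: mult_nonneg_nonpos)
    then show ?thesis using w[OF that] by simp
  qed
  show thesis
  proof (rule that[of r "\<lambda>s. w s - t * c s"])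
    show "r \<in> S" "w r - t * c r = 0" using r by (auto simp: P_def)
    show "(\<Sum>s\<in>S. w s - t * c s) = sum w S"
      by (simp add: sum_subtractf c0 flip: sum_distrib_left)
    have "(\<Sum>s\<in>S. (w s - t * c s) * a j s) = (\<Sum>s\<in>S. w s * a j s) - t * (\<Sum>s\<in>S. c s * a j s)" for j
      by (simp add: sum_subtractf sum_distrib_left left_diff_distrib mult.assoc)
    then show "\<forall>j\<in>J. (\<Sum>s\<in>S. (w s - t * c s) * a j s) = (\<Sum>s\<in>S. w s * a j s)"
      using cJ by simp
  qed (use nonneg in auto)
qed

section \<open>Convex combinations of least length\<close>

text \<open>Tychonoff's theorem, read off from the abstract product topology, which is the topology
  of the function type.\<close>

lemma compact_Pi_UNIV:
  fixes A :: "'x::topological_space set"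
  assumes "compact A"
  shows "compact (Pi UNIV (\<lambda>_. A) :: ('i \<Rightarrow> 'x) set)"
proof -
  have "compactin (product_topology (\<lambda>_::'i. euclidean :: 'x topology) UNIV) (PiE UNIV (\<lambda>_. A))"
    unfolding compactin_PiE using assms by (simp add: compactin_euclidean_iff)
  then show ?thesis
    by (simp add: euclidean_product_topology compactin_euclidean_iff PiE_UNIV_domain)
qed

text \<open>The squared length is continuous in weights and points jointly, and these range over a
  product of compact sets.\<close>

lemma closest_convex_combination:
  fixes \<phi> :: "'b \<Rightarrow> 'x::topological_space \<Rightarrow> real" and m :: nat
  assumes "finite B" "compact A" "A \<noteq> {}" "1 \<le> m" and cont: "\<And>b. b \<in> B \<Longrightarrow> continuous_on A (\<phi> b)"
  obtains x w where "\<forall>i. x i \<in> A" "\<forall>i. 0 \<le> w i" "(\<Sum>i=1..m. w i) = 1"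
    "\<forall>w' x'. (\<forall>i\<in>{1..m}. x' i \<in> A) \<longrightarrow> (\<forall>i\<in>{1..m}. 0 \<le> w' i) \<longrightarrow>
      (\<Sum>i=1..m. w' i) = 1 \<longrightarrow>
      (\<Sum>b\<in>B. (\<Sum>i=1..m. w i * \<phi> b (x i))\<^sup>2) \<le> (\<Sum>b\<in>B. (\<Sum>i=1..m. w' i * \<phi> b (x' i))\<^sup>2)"
proof -
  \<comment> \<open>Weights and points are functions on all of \<open>nat\<close>, so that Tychonoff
    applies. The bound by 1 gives compactness and excludes nothing on \<open>{1..m}\<close>, where
    nonnegative weights sum to 1.\<close>
  define W :: "(nat \<Rightarrow> real) set" where
    "W = Pi UNIV (\<lambda>_. {0..1}) \<inter> {w. (\<Sum>i=1..m. w i) = 1}"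
  define X :: "(nat \<Rightarrow> 'x) set" where "X = Pi UNIV (\<lambda>_. A)"
  define F where "F = (\<lambda>(w::nat \<Rightarrow> real, x). \<Sum>b\<in>B. (\<Sum>i=1..m. w i * \<phi> b (x i))\<^sup>2)"
  have "closed {w::nat \<Rightarrow> real. (\<Sum>i=1..m. w i) = 1}"
    by (intro closed_Collect_eq continuous_intros continuous_on_product_coordinates)
  then have "compact W"
    unfolding W_def by (intro compact_Int_closed compact_Pi_UNIV compact_Icc)
  moreover have "compact X" unfolding X_def by (intro compact_Pi_UNIV assms)
  ultimately have cpt: "compact (W \<times> X)" by (rule compact_Times)
  obtain z where z: "z \<in> A" using assms by auto
  have "(\<lambda>i. if i = 1 then 1 else 0) \<in> W" using assms(4) by (auto simp: W_def)
  then have ne: "W \<times> X \<noteq> {}" using z by (auto simp: X_def)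
  have "continuous_on (W \<times> X) (\<lambda>q. \<phi> b (snd q i))" if "b \<in> B" for b i
    by (rule continuous_on_compose2[OF cont[OF that]])
      (auto simp: X_def intro!: continuous_on_compose2[OF continuous_on_product_coordinates] continuous_on_snd continuous_on_id)
  moreover have "continuous_on (W \<times> X) (\<lambda>q. fst q i)" for i
    by (auto intro!: continuous_on_compose2[OF continuous_on_product_coordinates] continuous_on_fst continuous_on_id)
  ultimately have "continuous_on (W \<times> X) F"
    unfolding F_def case_prod_beta by (intro continuous_intros) auto
  then obtain q where q: "q \<in> W \<times> X" "\<And>q'. q' \<in> W \<times> X \<Longrightarrow> F q \<le> F q'"
    using continuous_attains_inf[OF cpt ne] by blast
  obtain x w where wx: "q = (w, x)" by (cases q)
  show thesis
  proof (rule that[of x w]; (intro allI impI)?)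
    show "x i \<in> A" "0 \<le> w i" "(\<Sum>i=1..m. w i) = 1" for i
      using q(1) by (auto simp: wx W_def X_def Pi_iff)
    fix w' :: "nat \<Rightarrow> real" and x' assume x': "\<forall>i\<in>{1..m}. x' i \<in> A"
      and w': "\<forall>i\<in>{1..m}. 0 \<le> w' i" and w1: "(\<Sum>i=1..m. w' i) = 1"
    \<comment> \<open>A competitor is constrained on \<open>{1..m}\<close> only; resetting it
      elsewhere puts it into \<open>W \<times> X\<close> and leaves \<open>F\<close>
      unchanged.\<close>
    define w'' where "w'' i = (if i \<in> {1..m} then w' i else 0)" for i
    define x'' where "x'' i = (if i \<in> {1..m} then x' i else z)" for i
    have "w' i \<le> 1" if "i \<in> {1..m}" for i
      using member_le_sum[OF that, of w'] w' w1 by auto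
    then have "(w'', x'') \<in> W \<times> X"
      using w' x' w1 z by (auto simp: W_def X_def w''_def x''_def)
    from q(2)[OF this] show "(\<Sum>b\<in>B. (\<Sum>i=1..m. w i * \<phi> b (x i))\<^sup>2) \<le>
        (\<Sum>b\<in>B. (\<Sum>i=1..m. w' i * \<phi> b (x' i))\<^sup>2)"
      by (simp add: wx F_def w''_def x''_def)
  qed
qed

text \<open>A theorem of the alternative in the manner of Gordan, with Caratheodory's count of
  points built in: were the shortest combination \<open>y\<close> nonzero, \<open>nosep\<close> for
  \<open>c = y\<close> would supply a point \<open>z\<close> towards which \<open>y\<close> can be
  shortened.\<close>

lemma zero_moments_if_not_separated:
  fixes \<phi> :: "'b \<Rightarrow> 'x::topological_space \<Rightarrow> real"
  assumes "finite B" "compact A" "A \<noteq> {}" and cont: "\<And>b. b \<in> B \<Longrightarrow> continuous_on A (\<phi> b)"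
    and nosep: "\<And>c. \<exists>z\<in>A. (\<Sum>b\<in>B. c b * \<phi> b z) \<le> 0"
  obtains x w where "\<forall>i. x i \<in> A" "\<forall>i. 0 \<le> w i" "(\<Sum>i=1..card B + 1. w i) = 1"
    "\<forall>b\<in>B. (\<Sum>i=1..card B + 1. w i * \<phi> b (x i)) = 0"
proof -
  define m where "m = card B + 1"
  have "1 \<le> m" by (simp add: m_def)
  then obtain x w where x: "\<forall>i. x i \<in> A" and w: "\<forall>i. 0 \<le> w i" and w1: "(\<Sum>i=1..m. w i) = 1"
    and min[rule_format]: "\<forall>w' x'. (\<forall>i\<in>{1..m}. x' i \<in> A) \<longrightarrow> (\<forall>i\<in>{1..m}. 0 \<le> w' i) \<longrightarrow>
      (\<Sum>i=1..m. w' i) = 1 \<longrightarrow>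
      (\<Sum>b\<in>B. (\<Sum>i=1..m. w i * \<phi> b (x i))\<^sup>2) \<le> (\<Sum>b\<in>B. (\<Sum>i=1..m. w' i * \<phi> b (x' i))\<^sup>2)"
    by (rule closest_convex_combination[of B A m \<phi>, OF assms(1-3)]) (use cont in simp)
  define y where "y b = (\<Sum>i=1..m. w i * \<phi> b (x i))" for b
  define E where "E = (\<Sum>b\<in>B. (y b)\<^sup>2)"
  have "E = 0"
  proof (rule ccontr)
    assume "E \<noteq> 0"
    then have "0 < E" unfolding E_def by (simp add: sum_nonneg less_le)
    obtain z where z: "z \<in> A" "(\<Sum>b\<in>B. y b * \<phi> b z) \<le> 0" using nosep by blast
    define P where "P = (\<Sum>b\<in>B. y b * \<phi> b z)"
    define Q where "Q = (\<Sum>b\<in>B. (\<phi> b z)\<^sup>2)"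
    have "0 \<le> Q" by (simp add: Q_def sum_nonneg)
    \<comment> \<open>Adjoining \<open>z\<close> gives \<open>m + 1\<close> points, one more than
      the minimality of \<open>y\<close> covers; the exchange brings them back to \<open>m\<close>
      with the same moments.\<close>
    have segment: "E \<le> (\<Sum>b\<in>B. ((1 - t) * y b + t * \<phi> b z)\<^sup>2)" if t: "0 \<le> t" "t \<le> 1" for t
    proof -
      \<comment> \<open>Slot \<open>0\<close> lies outside \<open>{1..m}\<close> and is free to hold
        \<open>z\<close>.\<close>
      define x0 where "x0 = x(0 := z)"
      define w0 where "w0 i = (if i = 0 then t else (1 - t) * w i)" for i
      have split: "{0..m} = insert 0 {1..m}" by auto
      have sum0: "sum g {0..m} = g 0 + sum g {1..m}" for g :: "nat \<Rightarrow> real"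
        unfolding split by simp
      have w0_sum: "sum w0 {0..m} = 1"
        using w1 by (simp add: sum0 w0_def flip: sum_distrib_left)
      have w0_y: "(\<Sum>i=0..m. w0 i * \<phi> b (x0 i)) = (1 - t) * y b + t * \<phi> b z" for b
        by (simp add: sum0 w0_def x0_def y_def sum_distrib_left mult.assoc)
      have "card B + 1 < card {0..m}" by (simp add: m_def)
      moreover have "\<And>i. i \<in> {0..m} \<Longrightarrow> 0 \<le> w0 i" using t w by (simp add: w0_def)
      ultimately obtain r w' where r: "r \<in> {0..m}" "w' r = 0"
        and w': "\<forall>i\<in>{0..m}. 0 \<le> w' i" "sum w' {0..m} = sum w0 {0..m}"
        "\<forall>b\<in>B. (\<Sum>i\<in>{0..m}. w' i * \<phi> b (x0 i)) = (\<Sum>i\<in>{0..m}. w0 i * \<phi> b (x0 i))"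
        by (rule Caratheodory_exchange[OF \<open>finite B\<close> finite_atLeastAtMost])
      \<comment> \<open>move index \<open>0\<close> into the freed slot \<open>r\<close>\<close>
      define \<pi> where "\<pi> i = (if i = r then 0 else i)" for i :: nat
      have drop: "(\<Sum>i=1..m. w' (\<pi> i) * g (\<pi> i)) = (\<Sum>i=0..m. w' i * g i)" for g :: "nat \<Rightarrow> real"
      proof -
        have "bij_betw \<pi> {1..m} ({0..m} - {r})"
          using r by (intro bij_betwI[where g = "\<lambda>i. if i = 0 then r else i"]) (auto simp: \<pi>_def)
        then have "(\<Sum>i=1..m. w' (\<pi> i) * g (\<pi> i)) = (\<Sum>i\<in>{0..m} - {r}. w' i * g i)"
          by (rule sum.reindex_bij_betw)
        then show ?thesis using r by (simp add: sum.remove[of "{0..m}" r])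
      qed
      have "E \<le> (\<Sum>b\<in>B. (\<Sum>i=1..m. w' (\<pi> i) * \<phi> b (x0 (\<pi> i)))\<^sup>2)"
        unfolding E_def y_def
      proof (rule min)
        show "(\<Sum>i=1..m. w' (\<pi> i)) = 1"
          using drop[of "\<lambda>_. 1"] w'(2) w0_sum by simp
      qed (use x z w' in \<open>auto simp: \<pi>_def x0_def\<close>)
      also have "\<dots> = (\<Sum>b\<in>B. ((1 - t) * y b + t * \<phi> b z)\<^sup>2)"
        by (intro sum.cong refl) (use w'(3) in \<open>simp only: drop[where g = "\<lambda>i. \<phi> _ (x0 i)"] w0_y\<close>)
      finally show ?thesis .
    qed
    \<comment> \<open>The minimiser of \<open>(1 - t)\<^sup>2 * E + t\<^sup>2 * Q\<close>, the bound
      that remains once the cross term with \<open>P \<le> 0\<close> is dropped; the minimum is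
      \<open>E - t * E\<close>.\<close>
    define t where "t = E / (E + Q)"
    have t: "0 < t" "t \<le> 1" "t * (E + Q) = E"
      using \<open>0 < E\<close> \<open>0 \<le> Q\<close> by (auto simp: t_def)
    have "E \<le> (\<Sum>b\<in>B. ((1 - t) * y b + t * \<phi> b z)\<^sup>2)" using segment t by simp
    also have "\<dots> = (\<Sum>b\<in>B. (1 - t)\<^sup>2 * (y b)\<^sup>2 + (2 * t * (1 - t)) * (y b * \<phi> b z) + t\<^sup>2 * (\<phi> b z)\<^sup>2)"
      by (intro sum.cong refl) (simp add: power2_eq_square algebra_simps)
    also have "\<dots> = (1 - t)\<^sup>2 * E + 2 * t * (1 - t) * P + t\<^sup>2 * Q"
      by (simp add: sum.distrib E_def P_def Q_def sum_distrib_left)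
    also have "\<dots> \<le> (1 - t)\<^sup>2 * E + t\<^sup>2 * Q"
      using t z(2) by (simp add: P_def mult_nonneg_nonpos)
    also have "\<dots> = E - 2 * t * E + t * (t * (E + Q))"
      by (simp add: power2_eq_square algebra_simps)
    also have "\<dots> = E - t * E" using t by simp
    finally show False using mult_pos_pos[OF t(1) \<open>0 < E\<close>] by simp
  qed
  then have "\<forall>b\<in>B. y b = 0"
    unfolding E_def using \<open>finite B\<close> by (simp add: sum_nonneg_eq_0_iff)
  then show thesis using that[of x w] x w w1 unfolding m_def y_def by blast
qed

section \<open>The weighted inner product\<close>

text \<open>For positive weights, an isometry from the weighted to the Euclidean structure; through
  it Cauchy-Schwarz and the expansion of squares carry over to \<open>winner\<close> and
  \<open>wnorm\<close>.\<close>

definition weight_scale :: "('d::finite \<Rightarrow> real) \<Rightarrow> real ^ 'd \<Rightarrow> real ^ 'd" where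
  "weight_scale p r = (\<chi> l. sqrt (p l) * r $ l)"

locale positive_weights =
  fixes p :: "'d::finite \<Rightarrow> real"
  assumes p_pos: "0 < p l"
begin

lemma linear_weight_scale: "linear (weight_scale p)"
  by (rule linearI) (simp_all add: weight_scale_def vec_eq_iff algebra_simps)

lemma winner_eq_inner: "winner p a b = inner (weight_scale p a) (weight_scale p b)"
proof -
  have "sqrt (p l) * a $ l * (sqrt (p l) * b $ l) = p l * a $ l * b $ l" for l
    proof -
    have "sqrt (p l) * a $ l * (sqrt (p l) * b $ l) = (sqrt (p l) * sqrt (p l)) * a $ l * b $ l"
      by (simp only: ac_simps)
    then show ?thesis using p_pos[of l] by simp
  qed
  then show ?thesis by (simp only: winner_def inner_vec_def weight_scale_def inner_real_def vec_lambda_beta)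
qed

lemma wnorm_eq_norm: "wnorm p a = norm (weight_scale p a)"
proof -
  have "(\<Sum>l\<in>UNIV. p l * \<bar>a $ l\<bar>\<^sup>2) = winner p a a"
    by (simp add: winner_def power2_eq_square mult.assoc)
  then show ?thesis by (simp add: wnorm_def winner_eq_inner norm_eq_sqrt_inner)
qed

lemma winner_self: "winner p a a = (wnorm p a)\<^sup>2"
  by (simp add: winner_eq_inner wnorm_eq_norm power2_norm_eq_inner)

lemma abs_winner_le: "\<bar>winner p a b\<bar> \<le> wnorm p a * wnorm p b"
  by (simp add: winner_eq_inner wnorm_eq_norm Cauchy_Schwarz_ineq2)

lemma winner_scaleR_right: "winner p a (t *\<^sub>R b) = t * winner p a b"
  by (simp add: winner_eq_inner linear_scale[OF linear_weight_scale])

lemma winner_add_right: "winner p a (b + c) = winner p a b + winner p a c"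
  by (simp add: winner_eq_inner linear_add[OF linear_weight_scale] inner_add_right)

lemma winner_sum_right: "winner p a (sum g I) = (\<Sum>i\<in>I. winner p a (g i))"
  by (simp add: winner_eq_inner linear_sum[OF linear_weight_scale] inner_sum_right)

lemma wnorm_diff_power2: "(wnorm p (a - b))\<^sup>2 = (wnorm p a)\<^sup>2 - 2 * winner p a b + (wnorm p b)\<^sup>2"
  by (simp add: wnorm_eq_norm winner_eq_inner linear_diff[OF linear_weight_scale]
      power2_norm_eq_inner inner_diff_left inner_diff_right inner_commute)

lemma wnorm_scaleR: "wnorm p (t *\<^sub>R a) = \<bar>t\<bar> * wnorm p a"
  by (simp add: wnorm_eq_norm linear_scale[OF linear_weight_scale])

lemma wnorm_nonneg: "0 \<le> wnorm p a"
  by (simp add: wnorm_eq_norm)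

lemma wnorm_eq_0_iff: "wnorm p a = 0 \<longleftrightarrow> a = 0"
proof -
  have "p l \<noteq> 0" for l using p_pos[of l] by simp
  then show ?thesis by (simp add: wnorm_eq_norm weight_scale_def vec_eq_iff)
qed

lemma continuous_on_wnorm: "continuous_on S (\<lambda>x. wnorm p (apply_bcontfun g x))"
  unfolding wnorm_def by (intro continuous_intros continuous_on_apply_bcontfun)

lemma continuous_on_winner:
  "continuous_on S (\<lambda>x. winner p (apply_bcontfun g x) (apply_bcontfun h x))"
  unfolding winner_def by (intro continuous_intros continuous_on_apply_bcontfun)

end

section \<open>The weighted sup norm and its extreme points\<close>

text \<open>The parameter \<open>X\<close> is a type token: it ties the locale to the type
  \<open>'x\<close> whose compactness is assumed.\<close>

locale positive_weights_compact = positive_weights p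
  for p :: "'d::finite \<Rightarrow> real" +
  fixes X :: "'x::topological_space itself"
  assumes compact_X: "compact (UNIV :: 'x set)"
begin

text \<open>Compactness turns the supremum into a maximum; the domain is nonempty as every type
  is.\<close>

lemma wsupnorm_attained:
  fixes g :: "'x \<Rightarrow>\<^sub>C (real ^ 'd)"
  obtains x where "wnorm p (g x) = wsupnorm p g" "\<And>y. wnorm p (g y) \<le> wsupnorm p g"
proof -
  obtain x where x: "\<And>y. wnorm p (g y) \<le> wnorm p (g x)"
    using continuous_attains_sup[OF compact_X _ continuous_on_wnorm[of UNIV g]] by auto
  then have "wsupnorm p g = wnorm p (g x)"
    unfolding wsupnorm_def by (intro cSup_eq_maximum) auto
  then show thesis using that[of x] x by simp
qed

lemma wnorm_le_wsupnorm:
  fixes g :: "'x \<Rightarrow>\<^sub>C (real ^ 'd)"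
  shows "wnorm p (g x) \<le> wsupnorm p g"
  using wsupnorm_attained[of g] by blast

lemma wsupnorm_nonneg:
  fixes g :: "'x \<Rightarrow>\<^sub>C (real ^ 'd)"
  shows "0 \<le> wsupnorm p g"
  using wnorm_le_wsupnorm[of g] wnorm_nonneg order_trans by blast

lemma wsupnorm_pos:
  fixes g :: "'x \<Rightarrow>\<^sub>C (real ^ 'd)"
  assumes "g \<noteq> 0"
  shows "0 < wsupnorm p g"
proof (rule ccontr)
  assume "\<not> 0 < wsupnorm p g"
  then have "wnorm p (g x) = 0" for x
    using wnorm_le_wsupnorm[of g x] wnorm_nonneg[of "g x"] by simp
  then have "g = 0" by (intro bcontfun_eqI) (simp add: wnorm_eq_0_iff)
  with assms show False by simp
qed

lemma extreme_points_nonempty: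
  fixes g :: "'x \<Rightarrow>\<^sub>C (real ^ 'd)"
  shows "extreme_points p g \<noteq> {}"
  using wsupnorm_attained[of g] by (auto simp: extreme_points_def)

lemma compact_extreme_points:
  fixes g :: "'x \<Rightarrow>\<^sub>C (real ^ 'd)"
  shows "compact (extreme_points p g)"
proof -
  have "closed (extreme_points p g)"
    unfolding extreme_points_def by (intro closed_Collect_eq continuous_on_wnorm continuous_on_const)
  from compact_Int_closed[OF compact_X this] show ?thesis by simp
qed

text \<open>Compactness makes positivity uniform: at every point either the pairing with
  \<open>v\<close> is bounded below, and the linear term in \<open>t\<close> beats the quadratic
  one, or the error stays below its maximum by a fixed margin that a small \<open>t\<close> cannot
  use up.\<close>

lemma wsupnorm_decrease:
  fixes e v :: "'x \<Rightarrow>\<^sub>C (real ^ 'd)"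
  assumes pos: "\<And>x. x \<in> extreme_points p e \<Longrightarrow> 0 < winner p (e x) (v x)"
  shows "\<exists>t. wsupnorm p (e - t *\<^sub>R v) < wsupnorm p e"
proof -
  define N where "N = wsupnorm p e"
  define g where "g x = winner p (e x) (v x)" for x
  have N0: "0 \<le> N" unfolding N_def by (rule wsupnorm_nonneg)
  have le: "(wnorm p (e x))\<^sup>2 \<le> N\<^sup>2" for x
    unfolding N_def by (intro power_mono wnorm_le_wsupnorm wnorm_nonneg)
  \<comment> \<open>Both summands are nonnegative. The first vanishes only at extreme points, where
    the second is positive, so the minimum of \<open>h\<close> is positive.\<close>
  define h where "h x = N\<^sup>2 - (wnorm p (e x))\<^sup>2 + max (g x) 0" for x
  have "continuous_on UNIV h"
    unfolding h_def g_def by (intro continuous_intros continuous_on_wnorm continuous_on_winner)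
  then obtain x0 where x0: "\<And>x. h x0 \<le> h x"
    using continuous_attains_inf[OF compact_X] by auto
  define \<mu> where "\<mu> = h x0"
  have "0 < \<mu>"
  proof (cases "x0 \<in> extreme_points p e")
    case True
    then show ?thesis using pos[OF True] le[of x0] by (simp add: \<mu>_def h_def g_def)
  next
    case False
    then have "wnorm p (e x0) < N"
      using wnorm_le_wsupnorm[of e x0] by (simp add: extreme_points_def N_def)
    then have "(wnorm p (e x0))\<^sup>2 < N\<^sup>2" by (intro power_strict_mono wnorm_nonneg) auto
    then show ?thesis by (simp add: \<mu>_def h_def)
  qed
  define M where "M = wsupnorm p v"
  have M0: "0 \<le> M" unfolding M_def by (rule wsupnorm_nonneg)
  \<comment> \<open>For \<open>0 \<le> t \<le> 1\<close> the squared error grows by at most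
    \<open>t * R\<close>; the \<open>+ 1\<close> keeps \<open>R\<close> positive for the division
    below.\<close>
  define R where "R = 2 * (N * M) + M\<^sup>2 + 1"
  have R: "1 \<le> R" "M\<^sup>2 \<le> R" using N0 M0 by (simp_all add: R_def)
  define t where "t = min 1 (\<mu> / (4 * R))"
  have t: "0 < t" "t \<le> 1" using \<open>0 < \<mu>\<close> R by (auto simp: t_def)
  have tR: "t * R \<le> \<mu> / 4"
  proof -
    have "t * R \<le> \<mu> / (4 * R) * R" using R by (intro mult_right_mono) (auto simp: t_def)
    then show ?thesis using R by simp
  qed
  have small: "(wnorm p ((e - t *\<^sub>R v) x))\<^sup>2 < N\<^sup>2" for x
  proof -
    have "(wnorm p (v x))\<^sup>2 \<le> M\<^sup>2"
      unfolding M_def by (intro power_mono wnorm_le_wsupnorm wnorm_nonneg)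
    then have tv: "t\<^sup>2 * (wnorm p (v x))\<^sup>2 \<le> t * (t * M\<^sup>2)"
      by (simp add: power2_eq_square mult.assoc mult_left_mono t(1) less_imp_le)
    have eq: "(wnorm p ((e - t *\<^sub>R v) x))\<^sup>2 = (wnorm p (e x))\<^sup>2 - 2 * t * g x + t\<^sup>2 * (wnorm p (v x))\<^sup>2"
      by (simp add: wnorm_diff_power2 winner_scaleR_right wnorm_scaleR power_mult_distrib g_def)
    have \<mu>x: "\<mu> \<le> h x" unfolding \<mu>_def by (rule x0)
    have tM: "t * M\<^sup>2 \<le> \<mu> / 4"
      using mult_left_mono[OF R(2), of t] t tR by linarith
    show ?thesis
    \<comment> \<open>If \<open>g x\<close> is small, \<open>h x \<ge> \<mu>\<close> leaves a margin
      of \<open>\<mu> / 2\<close> in the squared norm, against a growth of at most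
      \<open>\<mu> / 4\<close>. Otherwise the linear gain \<open>2 * t * g x\<close> exceeds the
      quadratic term.\<close>
    proof (cases "g x \<le> \<mu> / 2")
      case True
      have "\<bar>g x\<bar> \<le> N * M"
        unfolding g_def N_def M_def
        by (rule order_trans[OF abs_winner_le])
          (intro mult_mono wnorm_le_wsupnorm wnorm_nonneg wsupnorm_nonneg)
      then have "t * (- g x) \<le> t * (N * M)" using t by (intro mult_left_mono) auto
      moreover have "t * (t * M\<^sup>2) \<le> t * M\<^sup>2"
        using t by (intro mult_left_mono mult_left_le_one_le) auto
      moreover have "t * R = 2 * (t * (N * M)) + t * M\<^sup>2 + t" by (simp add: R_def algebra_simps)
      moreover have "(wnorm p (e x))\<^sup>2 \<le> N\<^sup>2 - \<mu> / 2"
        using \<mu>x True \<open>0 < \<mu>\<close> unfolding h_def by linarith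
      ultimately show ?thesis using eq tv tR t(1) \<open>0 < \<mu>\<close> by linarith
    next
      case False
      have "t * (t * M\<^sup>2) < t * (2 * g x)" using tM False \<open>0 < \<mu>\<close> t by (intro mult_strict_left_mono) auto
      then show ?thesis using eq tv le[of x] by simp
    qed
  qed
  \<comment> \<open>As the sup norm is attained, the strict pointwise bound passes to it.\<close>
  obtain x where x: "wnorm p ((e - t *\<^sub>R v) x) = wsupnorm p (e - t *\<^sub>R v)"
    using wsupnorm_attained[of "e - t *\<^sub>R v"] by blast
  have "wsupnorm p (e - t *\<^sub>R v) < N"
    using power_less_imp_less_base[OF small[of x] N0] x by simp
  then show ?thesis unfolding N_def by blast
qed

section \<open>The implications between the three conditions\<close>

lemma best_approximation_imp_annihilating_weights:
  fixes f u :: "'x \<Rightarrow>\<^sub>C (real ^ 'd)"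
  assumes best: "best_approximation p f (span B) u" and "finite B"
  obtains x w where "\<forall>i. x i \<in> extreme_points p (f - u)" "\<forall>i. 0 \<le> w i"
    "(\<Sum>i=1..card B + 1. w i) = 1"
    "\<forall>v\<in>span B. (\<Sum>i=1..card B + 1. w i * winner p ((f - u) (x i)) (v (x i))) = 0"
proof -
  define e where "e = f - u"
  have nosep: "\<exists>z\<in>extreme_points p e. (\<Sum>b\<in>B. c b * winner p (e z) (apply_bcontfun b z)) \<le> 0" for c
  proof (rule ccontr)
    assume neg: "\<not> ?thesis"
    define v where "v = (\<Sum>b\<in>B. c b *\<^sub>R b)"
    have "v \<in> span B" unfolding v_def by (intro span_sum span_scale span_base)
    have "apply_bcontfun v z = (\<Sum>b\<in>B. c b *\<^sub>R apply_bcontfun b z)" for z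
      unfolding v_def using \<open>finite B\<close> by (induction B rule: finite_induct) auto
    then have "winner p (e z) (v z) = (\<Sum>b\<in>B. c b * winner p (e z) (apply_bcontfun b z))" for z
      by (simp add: winner_sum_right winner_scaleR_right)
    then have "\<And>z. z \<in> extreme_points p e \<Longrightarrow> 0 < winner p (e z) (v z)"
      using neg by (auto simp: not_le)
    then obtain t where "wsupnorm p (e - t *\<^sub>R v) < wsupnorm p e"
      using wsupnorm_decrease by blast
    \<comment> \<open>\<open>e - t *\<^sub>R v\<close> is the error of this competitor.\<close>
    moreover have "u + t *\<^sub>R v \<in> span B"
      using best \<open>v \<in> span B\<close> by (auto simp: best_approximation_def intro: span_add span_scale)
    ultimately show False
      using best unfolding best_approximation_def e_def
      by (metis diff_diff_eq not_less)
  qed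
  have ct: "continuous_on (extreme_points p e) (\<lambda>z. winner p (e z) (b z))" for b :: "'x \<Rightarrow>\<^sub>C (real ^ 'd)"
    by (rule continuous_on_winner)
  obtain x w where wx: "\<forall>i. x i \<in> extreme_points p e" "\<forall>i. 0 \<le> w i" "(\<Sum>i=1..card B + 1. w i) = 1"
    "\<forall>b\<in>B. (\<Sum>i=1..card B + 1. w i * winner p (e (x i)) (apply_bcontfun b (x i))) = 0"
    by (rule zero_moments_if_not_separated[where \<phi> = "\<lambda>b z. winner p (e z) (apply_bcontfun b z)",
          OF \<open>finite B\<close> compact_extreme_points extreme_points_nonempty ct nosep])
  have "(\<Sum>i=1..card B + 1. w i * winner p (e (x i)) (v (x i))) = 0" if "v \<in> span B" for v
    using that
  proof (induction rule: span_induct_alt)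
    case base
    then show ?case by (simp add: winner_def)
  next
    case (step c b y)
    have "(\<Sum>i=1..card B + 1. w i * winner p (e (x i)) ((c *\<^sub>R b + y) (x i))) =
        c * (\<Sum>i=1..card B + 1. w i * winner p (e (x i)) (b (x i))) +
        (\<Sum>i=1..card B + 1. w i * winner p (e (x i)) (y (x i)))"
      by (simp only: plus_bcontfun.rep_eq scaleR_bcontfun.rep_eq winner_add_right
          winner_scaleR_right sum_distrib_left sum.distrib[symmetric]) (simp add: algebra_simps)
    then show ?case using step wx(4) by simp
  qed
  then show thesis using that[of x w] wx unfolding e_def by blast
qed

text \<open>With \<open>h = v - u\<close>, some chosen extreme point has a nonpositive pairing of
  \<open>e\<close> and \<open>h\<close>; expanding the square there shows that
  \<open>e - h = f - v\<close> is at least as large as \<open>e\<close>.\<close>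

lemma best_approximationI_Min_le:
  fixes f u :: "'x \<Rightarrow>\<^sub>C (real ^ 'd)" and \<nu> :: nat
  assumes "subspace V" "u \<in> V" "1 \<le> \<nu>"
    and x: "\<And>i. i \<in> {1..\<nu>} \<Longrightarrow> x i \<in> extreme_points p (f - u)"
    and Min: "\<And>v. v \<in> V \<Longrightarrow> Min ((\<lambda>i. winner p ((f - u) (x i)) (v (x i))) ` {1..\<nu>}) \<le> 0"
  shows "best_approximation p f V u"
  unfolding best_approximation_def
proof (intro conjI ballI)
  fix v assume "v \<in> V"
  define e where "e = f - u"
  define h where "h = v - u"
  have h: "h \<in> V" using \<open>v \<in> V\<close> assms by (simp add: h_def subspace_diff)
  \<comment> \<open>\<open>1 \<le> \<nu>\<close> makes the index set nonempty, so that
    \<open>Min\<close> is a genuine minimum.\<close>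
  have "\<exists>i\<in>{1..\<nu>}. winner p (e (x i)) (h (x i)) \<le> 0"
    using Min[OF h] \<open>1 \<le> \<nu>\<close> unfolding e_def[symmetric] by (subst (asm) Min_le_iff) auto
  then obtain i where i: "i \<in> {1..\<nu>}" "winner p (e (x i)) (h (x i)) \<le> 0" by blast
  have "(wsupnorm p e)\<^sup>2 = (wnorm p (e (x i)))\<^sup>2"
    using x[OF i(1)] by (simp add: extreme_points_def e_def)
  also have "\<dots> \<le> (wnorm p ((e - h) (x i)))\<^sup>2"
    using i(2) zero_le_power2[of "wnorm p (h (x i))"]
    unfolding minus_bcontfun.rep_eq wnorm_diff_power2 by linarith
  finally have "wsupnorm p e \<le> wnorm p ((e - h) (x i))"
    by (rule power2_le_imp_le) (rule wnorm_nonneg)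
  also have "\<dots> \<le> wsupnorm p (e - h)" by (rule wnorm_le_wsupnorm)
  also have "e - h = f - v" by (simp add: e_def h_def)
  finally show "wsupnorm p (f - u) \<le> wsupnorm p (f - v)" by (simp add: e_def)
qed (rule assms)

text \<open>A minimum is at most any weighted average, and here the average is zero.\<close>

lemma Min_winner_le_0_if_annihilating:
  fixes e v :: "'x \<Rightarrow>\<^sub>C (real ^ 'd)" and \<nu> :: nat
  assumes w: "\<And>i. i \<in> {1..\<nu>} \<Longrightarrow> 0 \<le> w i" "(\<Sum>i=1..\<nu>. w i) = 1"
    and v: "(\<Sum>i=1..\<nu>. w i * winner p (e (x i)) (v (x i))) = 0"
  shows "Min ((\<lambda>i. winner p (e (x i)) (v (x i))) ` {1..\<nu>}) \<le> 0" (is "?m \<le> 0")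
proof -
  have "?m * (\<Sum>i=1..\<nu>. w i) = (\<Sum>i=1..\<nu>. w i * ?m)"
    by (subst mult.commute) (rule sum_distrib_right)
  also have "\<dots> \<le> (\<Sum>i=1..\<nu>. w i * winner p (e (x i)) (v (x i)))"
    using w by (intro sum_mono mult_left_mono Min_le) auto
  finally show ?thesis using w v by simp
qed

text \<open>Cauchy-Schwarz at each point bounds the functional by the sup norm, and \<open>e\<close>
  gives equality because the points are extreme.\<close>

lemma point_functional_norming:
  fixes e :: "'x \<Rightarrow>\<^sub>C (real ^ 'd)"
  assumes "e \<noteq> 0" and x: "\<And>i. i \<in> {1..\<nu>} \<Longrightarrow> x i \<in> extreme_points p e"
    and w: "\<And>i. i \<in> {1..\<nu>} \<Longrightarrow> 0 \<le> w i" "(\<Sum>i=1..\<nu>. w i) = 1"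
  shows "point_functional p e \<nu> x w e = wsupnorm p e" (is "_ = ?N")
    and "wopnorm p (point_functional p e \<nu> x w) = 1"
proof -
  let ?L = "point_functional p e \<nu> x w"
  have N: "0 < ?N" using assms by (intro wsupnorm_pos)
  have xe: "wnorm p (e (x i)) = ?N" if "i \<in> {1..\<nu>}" for i
    using x[OF that] by (simp add: extreme_points_def)
  have "(\<Sum>i=1..\<nu>. w i * winner p (e (x i)) (e (x i))) = (\<Sum>i=1..\<nu>. w i * ?N\<^sup>2)"
    by (intro sum.cong refl) (simp add: winner_self xe)
  also have "\<dots> = ?N\<^sup>2" using w by (simp flip: sum_distrib_right)
  finally show Le: "?L e = ?N" using N by (simp add: point_functional_def power2_eq_square)
  have "\<bar>?L g\<bar> \<le> wsupnorm p g" for g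
  proof -
    have "\<bar>\<Sum>i=1..\<nu>. w i * winner p (e (x i)) (g (x i))\<bar> \<le> (\<Sum>i=1..\<nu>. w i * (?N * wsupnorm p g))"
    proof (rule order_trans[OF sum_abs], rule sum_mono)
      fix i assume i: "i \<in> {1..\<nu>}"
      have "\<bar>winner p (e (x i)) (g (x i))\<bar> \<le> ?N * wnorm p (g (x i))"
        using abs_winner_le[of "e (x i)" "g (x i)"] xe[OF i] by simp
      also have "\<dots> \<le> ?N * wsupnorm p g"
        using N by (intro mult_left_mono wnorm_le_wsupnorm) auto
      finally show "\<bar>w i * winner p (e (x i)) (g (x i))\<bar> \<le> w i * (?N * wsupnorm p g)"
        using w(1)[OF i] by (simp add: abs_mult mult_left_mono)
    qed
    also have "\<dots> = ?N * wsupnorm p g" using w by (simp flip: sum_distrib_right)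
    finally show ?thesis
      using N by (simp add: point_functional_def abs_mult pos_divide_le_eq mult.commute)
  qed
  \<comment> \<open>If \<open>g\<close> has norm zero, the quotient is 0 by the convention for
    division.\<close>
  then have "\<bar>?L g\<bar> / wsupnorm p g \<le> 1" for g
    using wsupnorm_nonneg[of g] by (auto simp: divide_le_eq_1 less_le)
  then show "wopnorm p ?L = 1"
    unfolding wopnorm_def using Le N by (intro cSup_eq_maximum) (auto intro!: image_eqI[of _ _ e])
qed

end

section \<open>Assembly of the equivalences\<close>

theorem theorem4p2:
  fixes p :: "'d::finite \<Rightarrow> real"
    and f u \<epsilon> :: "'x::topological_space \<Rightarrow>\<^sub>C (real ^ 'd)"
    and V B :: "('x \<Rightarrow>\<^sub>C (real ^ 'd)) set"
    and n :: nat
  assumes p_pos: "\<And>l. 0 < p l"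
    and p_sum: "(\<Sum>l\<in>UNIV. p l) = 1"
    and compact_X: "compact (UNIV :: 'x set)"
    and subspace_V: "subspace V"
    and basis_V: "finite B" "independent B" "span B = V" "card B = n"
    and u_in_V: "u \<in> V"
    and eps: "\<epsilon> = f - u"
  shows
    \<comment> \<open>(i) iff (ii), and (i) iff (iii); the functional in (iii) is only defined for a nonzero error\<close>
    "(best_approximation p f V u \<longleftrightarrow>
      (\<exists>\<nu> x. 1 \<le> \<nu> \<and> \<nu> \<le> n + 1 \<and> (\<forall>i\<in>{1..\<nu>}. x i \<in> extreme_points p \<epsilon>) \<and>
        (\<forall>v\<in>V. Min ((\<lambda>i. winner p (\<epsilon> (x i)) (v (x i))) ` {1..\<nu>}) \<le> 0))) \<and>
     (\<epsilon> \<noteq> 0 \<longrightarrow>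
     (best_approximation p f V u \<longleftrightarrow>
      (\<exists>\<nu> x w. 1 \<le> \<nu> \<and> \<nu> \<le> n + 1 \<and> (\<forall>i\<in>{1..\<nu>}. x i \<in> extreme_points p \<epsilon>) \<and>
        (\<forall>i\<in>{1..\<nu>}. 0 \<le> w i) \<and> (\<Sum>i=1..\<nu>. w i) = 1 \<and>
        (let L = point_functional p \<epsilon> \<nu> x w in
          L \<epsilon> = wsupnorm p \<epsilon> \<and> wopnorm p L = 1 \<and> V \<subseteq> {v \<in> V. L v = 0}))))"
proof -
  interpret positive_weights_compact p "TYPE('x)"
    by unfold_locales (use p_pos compact_X in auto)
  \<comment> \<open>The core of (iii) without the factor \<open>1 / wsupnorm p \<epsilon>\<close>.
    It makes sense for \<open>\<epsilon> = 0\<close> as well, so it can serve as the link from (i)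
    to (ii) in all cases.\<close>
  define ann where "ann \<nu> x w \<longleftrightarrow> (\<forall>i\<in>{1..\<nu>}. x i \<in> extreme_points p \<epsilon>) \<and>
      (\<forall>i\<in>{1..\<nu>}. 0 \<le> w i) \<and> (\<Sum>i=1..\<nu>. w i) = 1 \<and>
      (\<forall>v\<in>V. (\<Sum>i=1..\<nu>. w i * winner p (\<epsilon> (x i)) (v (x i))) = 0)"
    for \<nu> :: nat and x :: "nat \<Rightarrow> 'x" and w :: "nat \<Rightarrow> real"
  \<comment> \<open>Exactly \<open>n + 1\<close> points can always be taken, since zero weights and
    repeated points are allowed.\<close>
  have best_ann: "\<exists>x w. ann (n + 1) x w" if "best_approximation p f V u"
  proof -
    have "best_approximation p f (span B) u" using that basis_V by simp
    then obtain x w where "\<forall>i. x i \<in> extreme_points p \<epsilon>" "\<forall>i. 0 \<le> w i" "(\<Sum>i=1..n + 1. w i) = 1"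
      "\<forall>v\<in>V. (\<Sum>i=1..n + 1. w i * winner p (\<epsilon> (x i)) (v (x i))) = 0"
      unfolding basis_V(3,4)[symmetric] eps
      by (rule best_approximation_imp_annihilating_weights[OF _ \<open>finite B\<close>])
    then show ?thesis unfolding ann_def by blast
  qed
  have ann_Min: "Min ((\<lambda>i. winner p (\<epsilon> (x i)) (v (x i))) ` {1..\<nu>}) \<le> 0"
    if "ann \<nu> x w" "v \<in> V" for \<nu> x w v
    using that unfolding ann_def by (intro Min_winner_le_0_if_annihilating[where w = w]) auto
  have Min_best: "best_approximation p f V u"
    if "1 \<le> \<nu>" "\<forall>i\<in>{1..\<nu>}. x i \<in> extreme_points p \<epsilon>"
      "\<forall>v\<in>V. Min ((\<lambda>i. winner p (\<epsilon> (x i)) (v (x i))) ` {1..\<nu>}) \<le> 0" for \<nu> :: nat and x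
    using that subspace_V u_in_V unfolding eps
    by (intro best_approximationI_Min_le[where \<nu> = \<nu> and x = x]) auto
  \<comment> \<open>For a nonzero error the two norm identities are automatic, and the nonzero
    factor does not affect the kernel.\<close>
  have ann_iff: "(\<forall>i\<in>{1..\<nu>}. x i \<in> extreme_points p \<epsilon>) \<and>
        (\<forall>i\<in>{1..\<nu>}. 0 \<le> w i) \<and> (\<Sum>i=1..\<nu>. w i) = 1 \<and>
        (let L = point_functional p \<epsilon> \<nu> x w in
          L \<epsilon> = wsupnorm p \<epsilon> \<and> wopnorm p L = 1 \<and> V \<subseteq> {v \<in> V. L v = 0}) \<longleftrightarrow> ann \<nu> x w"
    if "\<epsilon> \<noteq> 0" for \<nu> x w
  proof -
    have "point_functional p \<epsilon> \<nu> x w v = 0 \<longleftrightarrow>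
        (\<Sum>i=1..\<nu>. w i * winner p (\<epsilon> (x i)) (v (x i))) = 0" for v
      using wsupnorm_pos[OF that] by (simp add: point_functional_def)
    then show ?thesis
      using point_functional_norming[OF that, of \<nu> x w] unfolding ann_def Let_def by auto
  qed
  have "1 \<le> n + 1" "n + 1 \<le> n + 1" by auto
  show ?thesis
  proof (intro conjI impI)
    show "best_approximation p f V u \<longleftrightarrow>
      (\<exists>\<nu> x. 1 \<le> \<nu> \<and> \<nu> \<le> n + 1 \<and> (\<forall>i\<in>{1..\<nu>}. x i \<in> extreme_points p \<epsilon>) \<and>
        (\<forall>v\<in>V. Min ((\<lambda>i. winner p (\<epsilon> (x i)) (v (x i))) ` {1..\<nu>}) \<le> 0))" (is "_ \<longleftrightarrow> ?ii")
    proof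
      assume "best_approximation p f V u"
      then obtain x w where xw: "ann (n + 1) x w" using best_ann by blast
      then have "\<forall>i\<in>{1..n + 1}. x i \<in> extreme_points p \<epsilon>" unfolding ann_def by blast
      then show ?ii using ann_Min[OF xw] \<open>1 \<le> n + 1\<close> by blast
    qed (use Min_best in blast)
    assume "\<epsilon> \<noteq> 0"
    \<comment> \<open>The way back from the weights to (i) passes through the minimum condition of
      (ii).\<close>
    have "best_approximation p f V u \<longleftrightarrow> (\<exists>\<nu> x w. 1 \<le> \<nu> \<and> \<nu> \<le> n + 1 \<and> ann \<nu> x w)"
    proof
      assume "\<exists>\<nu> x w. 1 \<le> \<nu> \<and> \<nu> \<le> n + 1 \<and> ann \<nu> x w"
      then obtain \<nu> x w where a: "1 \<le> \<nu>" "ann \<nu> x w" by blast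
      then have "\<forall>i\<in>{1..\<nu>}. x i \<in> extreme_points p \<epsilon>" unfolding ann_def by blast
      then show "best_approximation p f V u" using Min_best[OF a(1)] ann_Min[OF a(2)] by blast
    qed (use best_ann \<open>1 \<le> n + 1\<close> in blast)
    then show "best_approximation p f V u \<longleftrightarrow>
      (\<exists>\<nu> x w. 1 \<le> \<nu> \<and> \<nu> \<le> n + 1 \<and> (\<forall>i\<in>{1..\<nu>}. x i \<in> extreme_points p \<epsilon>) \<and>
        (\<forall>i\<in>{1..\<nu>}. 0 \<le> w i) \<and> (\<Sum>i=1..\<nu>. w i) = 1 \<and>
        (let L = point_functional p \<epsilon> \<nu> x w in
          L \<epsilon> = wsupnorm p \<epsilon> \<and> wopnorm p L = 1 \<and> V \<subseteq> {v \<in> V. L v = 0}))"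
      unfolding ann_iff[OF \<open>\<epsilon> \<noteq> 0\<close>] .
  qed
qed

end
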